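(* Let $c>0$ and let $f\colon \mathbb{N}\to\mathbb{Z}$ be a function with $0\le f(k)\le ck$ for all positive integers $k$. Then for every real $x>0$, $$x-\#\{n\le x:\ n=k+f(k)\text{ for some positive integer }k\}\ \ge\ \frac{1}{(2c+2)x}\sum_{k\le x}f(k),$$ where $n$ and $k$ range over positive integers.
   Context: $\mathbb{N}=\{1,2,3,\dots\}$. *)

theory Defs
  imports Complex_Main
begin

end

theory Submission imports Defs begin

text \<open>
  Choose for every represented \<open>n \<le> N = \<lfloor>x\<rfloor>\<close> one \<open>k\<close> with \<open>n = k + f k\<close>; the \<open>k\<close> that are not
  chosen form a set \<open>B\<close> with as many elements as there are non-represented numbers up to \<open>N\<close>.
  The chosen \<open>k\<close> contribute to \<open>\<Sum> f k\<close> the sum of the represented \<open>n\<close> minus the sum of the chosen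
  \<open>k\<close>, which is at most the sum of the \<open>k\<close> in \<open>B\<close>. Hence \<open>\<Sum> f k\<close> is at most the sum of
  \<open>k + f k\<close> over \<open>B\<close>, so at most \<open>(1 + c) N |B|\<close>.
\<close>

lemma sum_le_card_nonrepresented:
  fixes c :: real and f :: "nat \<Rightarrow> int" and N :: nat
  assumes f: "\<And>k. k \<ge> 1 \<Longrightarrow> 0 \<le> f k \<and> real_of_int (f k) \<le> c * real k"
    and c: "c \<ge> 0"
  defines "A \<equiv> {n \<in> {1..N}. \<exists>k\<ge>1. int n = int k + f k}"
  shows "(\<Sum>k\<in>{1..N}. real_of_int (f k)) \<le> (1 + c) * real N * (real N - real (card A))"
proof -
  have "\<forall>n\<in>A. \<exists>k. k \<ge> 1 \<and> int n = int k + f k"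
    by (simp add: A_def)
  from bchoice[OF this] obtain g
    where g: "\<And>n. n \<in> A \<Longrightarrow> g n \<ge> 1 \<and> int n = int (g n) + f (g n)"
    by blast
  \<comment> \<open>The value \<open>g n\<close> determines \<open>n\<close>, as \<open>n\<close>
    equals \<open>g n + f (g n)\<close>.\<close>
  have inj: "inj_on g A"
    by (rule inj_onI) (metis g of_nat_eq_iff)
  \<comment> \<open>Since \<open>f\<close> is non-negative at \<open>g n\<close>,
    \<open>g n \<le> n \<le> N\<close>.\<close>
  have sub: "g ` A \<subseteq> {1..N}"
    using g f by (fastforce simp: A_def)
  define B where "B = {1..N} - g ` A"
  have fin: "finite A" "A \<subseteq> {1..N}" by (auto simp: A_def)
  have cardB: "real (card B) = real N - real (card A)"
    using card_Diff_subset[of "g ` A" "{1..N}"] card_mono[of "{1..N}" A] fin sub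
    by (simp add: B_def card_image[OF inj] of_nat_diff)
  have split: "(\<Sum>k\<in>{1..N}. h k) = (\<Sum>k\<in>B. h k) + (\<Sum>n\<in>A. h (g n))" for h :: "nat \<Rightarrow> real"
    using sum.subset_diff[OF sub, of h] by (simp add: B_def sum.reindex[OF inj])
  have "(\<Sum>n\<in>A. real_of_int (f (g n))) + (\<Sum>n\<in>A. real (g n)) = (\<Sum>n\<in>A. real n)"
    unfolding sum.distrib[symmetric]
  proof (rule sum.cong)
    fix n assume "n \<in> A"
    then show "real_of_int (f (g n)) + real (g n) = real n"
      using g[of n] by linarith
  qed simp
  also have "\<dots> \<le> (\<Sum>k\<in>{1..N}. real k)"
    by (rule sum_mono2) (use fin in auto)
  \<comment> \<open>The sum of the chosen \<open>g n\<close> now occurs on both sides and cancels,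
    leaving only \<open>B\<close> on the right.\<close>
  also note split[of real]
  finally have "(\<Sum>n\<in>A. real_of_int (f (g n))) \<le> (\<Sum>k\<in>B. real k)" by simp
  then have "(\<Sum>k\<in>{1..N}. real_of_int (f k)) \<le> (\<Sum>k\<in>B. real_of_int (f k) + real k)"
    unfolding split[of "\<lambda>k. real_of_int (f k)"] sum.distrib by simp
  also have "\<dots> \<le> of_nat (card B) * ((1 + c) * real N)"
  proof (rule sum_bounded_above)
    fix k assume "k \<in> B"
    then have "1 \<le> k" "k \<le> N" by (auto simp: B_def)
    have "real_of_int (f k) + real k \<le> (1 + c) * real k"
      using f[OF \<open>1 \<le> k\<close>] by (simp add: algebra_simps)
    also have "\<dots> \<le> (1 + c) * real N"
      using \<open>k \<le> N\<close> c by (intro mult_left_mono) auto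
    finally show "real_of_int (f k) + real k \<le> (1 + c) * real N" .
  qed
  finally show ?thesis by (simp add: cardB mult_ac)
qed

theorem theorem3:
  fixes c :: real and f :: "nat \<Rightarrow> int" and x :: real
  assumes "c > 0"
    and "\<And>k::nat. k \<ge> 1 \<Longrightarrow> 0 \<le> f k \<and> real_of_int (f k) \<le> c * real k"
    and "x > 0"
  shows "x - real (card {n::nat. 1 \<le> n \<and> real n \<le> x \<and> (\<exists>k::nat. 1 \<le> k \<and> int n = int k + f k)})
    \<ge> 1 / ((2 * c + 2) * x) * (\<Sum>k\<in>{k::nat. 1 \<le> k \<and> real k \<le> x}. real_of_int (f k))"
proof -
  define N where "N = nat \<lfloor>x\<rfloor>"
  define A where "A = {n \<in> {1..N}. \<exists>k\<ge>1. int n = int k + f k}"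
  \<comment> \<open>Positivity of \<open>x\<close> makes its floor non-negative, so
    \<open>nat\<close> does not alter it.\<close>
  have le_N: "real n \<le> x \<longleftrightarrow> n \<le> N" for n
    using \<open>x > 0\<close> unfolding N_def by (simp add: le_nat_iff le_floor_iff)
  have Nx: "real N \<le> x" by (simp add: le_N)
  have A_eq: "{n::nat. 1 \<le> n \<and> real n \<le> x \<and> (\<exists>k::nat. 1 \<le> k \<and> int n = int k + f k)} = A"
    by (auto simp: A_def le_N)
  have K_eq: "{k::nat. 1 \<le> k \<and> real k \<le> x} = {1..N}"
    by (auto simp: le_N)
  have cardA: "card A \<le> N"
    using card_mono[of "{1..N}" A] by (simp add: A_def subset_iff)
  have "(\<Sum>k\<in>{1..N}. real_of_int (f k)) \<le> (1 + c) * real N * (real N - real (card A))"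
    unfolding A_def using assms by (intro sum_le_card_nonrepresented) auto
  \<comment> \<open>Compare factor by factor: \<open>1 + c \<le> 2 * c + 2\<close> and
    \<open>N \<le> x\<close>, while \<open>cardA\<close> keeps \<open>N - card A\<close>
    non-negative.\<close>
  also have "\<dots> \<le> ((2 * c + 2) * x) * (x - real (card A))"
    using \<open>c > 0\<close> \<open>x > 0\<close> Nx cardA by (intro mult_mono) auto
  finally show ?thesis
    unfolding A_eq K_eq using \<open>c > 0\<close> \<open>x > 0\<close> by (simp add: divide_le_eq mult_ac)
qed

end
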